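(* Suppose $x \in \mathbb{R}^r$ has all coordinates nonzero, and at least two successive coordinates of $x$ have a common sign. Let $A_r \in \mathbb{R}^{r \times r}$ be $TP_{r-1}$. Then: (1) $S^+(A_rx) \leq S^-(x)$. If moreover equality holds, then the first (respectively, last) component of $A_rx$ (if zero, the unique sign required to determine $S^+(A_rx)$) has the same sign as the first (respectively, last) component of $x$. (2) There exists a coordinate $i \in \{1,\ldots,r\}$ such that $x_i(A_rx)_i>0$.
   Context: A real matrix is $TP_k$ (totally positive of order $k$) if all its minors of order at most $k$ are positive. For $v\in\mathbb{R}^p$, $S^-(v)$ is the number of sign changes in the sequence of coordinates of $v$ after deleting all zero entries, and $S^+(v)$ is the maximum possible number of sign changes in the sequence obtained by assigning each zero entry of $v$ an arbitrary value $\pm1$. For the zero vector $0\in\mathbb{R}^p$ one sets $S^+(0):=p$ and $S^-(0):=0$. The phrase "if zero, the unique sign required to determine $S^+(v)$" for the first (last) component of a vector $v$ means: if this component is $0$, its sign is taken to be the sign it must receive in an assignment of $\pm1$ to the zero entries of $v$ attaining the maximum $S^+(v)$. *)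

theory Defs
  imports "Jordan_Normal_Form.Determinant" "Jordan_Normal_Form.DL_Submatrix"
begin

definition totally_positive :: "nat \<Rightarrow> real mat \<Rightarrow> bool" where
  "totally_positive k A \<longleftrightarrow>
    (\<forall>I J. I \<subseteq> {..<dim_row A} \<and> J \<subseteq> {..<dim_col A} \<and> card I = card J \<and> 1 \<le> card I \<and> card I \<le> k
      \<longrightarrow> det (submatrix A I J) > 0)"

text \<open>Intended for lists without zero entries.\<close>

definition sign_changes :: "real list \<Rightarrow> nat" where
  "sign_changes xs = card {i. Suc i < length xs \<and> xs ! i * xs ! Suc i < 0}"

definition S_minus :: "real vec \<Rightarrow> nat" where
  "S_minus v = sign_changes (filter (\<lambda>a. a \<noteq> 0) (list_of_vec v))"

definition zero_fillings :: "real vec \<Rightarrow> real vec set" where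
  "zero_fillings v = {w. dim_vec w = dim_vec v \<and>
     (\<forall>i < dim_vec v. if v $ i = 0 then w $ i \<in> {1, -1} else w $ i = v $ i)}"

definition S_plus :: "real vec \<Rightarrow> nat" where
  "S_plus v = (if v = 0\<^sub>v (dim_vec v) then dim_vec v
     else Max ((\<lambda>w. sign_changes (list_of_vec w)) ` zero_fillings v))"

text \<open>
  \<open>S_plus_sign v i s\<close>: the fillings attaining the value \<open>S_plus v\<close> exist, and all of them have
  sign \<open>s\<close> at coordinate \<open>i\<close>. If \<open>v $ i\<close> is nonzero, then \<open>s\<close> is its sign. The relation is
  empty for \<open>v = 0\<close> in positive dimension, where no filling has \<open>dim_vec v\<close> sign changes.
\<close>

definition S_plus_sign :: "real vec \<Rightarrow> nat \<Rightarrow> real \<Rightarrow> bool" where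
  "S_plus_sign v i s \<longleftrightarrow>
    (\<lambda>w. sgn (w $ i)) ` {w \<in> zero_fillings v. sign_changes (list_of_vec w) = S_plus v} = {s}"

end

theory Submission
  imports Defs
begin

text \<open>
  Let \<open>s\<close> be the number of sign changes of \<open>x\<close>. Collapsing the columns of \<open>A\<close> along the \<open>s + 1\<close>
  blocks of constant sign of \<open>x\<close>, with weights \<open>\<bar>x\<^sub>j\<bar>\<close>, gives a matrix \<open>B\<close> whose
  minors are positive combinations of minors of \<open>A\<close> of order at most \<open>s + 1 \<le> r - 1\<close>, and
  \<open>A x = B d\<close> with \<open>d = \<plusminus>(1, -1, 1, \<dots>)\<close>. If the entries of \<open>A x\<close> weakly alternate on \<open>s + 1\<close> rows,
  Cramer's rule for the first unknown shows that they start with the sign of \<open>x\<^sub>0\<close>.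
  If a filling of \<open>A x\<close> had \<open>s + 1\<close> sign changes, it would alternate on \<open>s + 2\<close> rows, and dropping
  the last or the first of them would lead to opposite starting signs. The second claim follows from
  the first: if all products \<open>x\<^sub>i (A x)\<^sub>i\<close> were nonpositive, the signs of \<open>-x\<close> would
  be a filling of \<open>A x\<close> with \<open>s\<close> sign changes and the wrong first sign.
\<close>

subsection \<open>Counting sign changes\<close>

text \<open>As a function of the prefix, the count also serves as a block index: for nonvanishing
  \<open>f\<close>, positions in a common maximal run of constant sign are exactly those with the
  same count.\<close>

definition changes_upto :: "(nat \<Rightarrow> real) \<Rightarrow> nat \<Rightarrow> nat" where
  "changes_upto f n = card {i. i < n \<and> f i * f (Suc i) < 0}"

lemma changes_upto_0 [simp]: "changes_upto f 0 = 0"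
  by (simp add: changes_upto_def)

lemma changes_upto_Suc:
  "changes_upto f (Suc n) = changes_upto f n + (if f n * f (Suc n) < 0 then 1 else 0)"
proof -
  have "{i. i < Suc n \<and> f i * f (Suc i) < 0} =
      (if f n * f (Suc n) < 0 then insert n {i. i < n \<and> f i * f (Suc i) < 0}
       else {i. i < n \<and> f i * f (Suc i) < 0})"
    by (auto simp: less_Suc_eq)
  then show ?thesis
    by (simp add: changes_upto_def)
qed

lemma mono_changes_upto: "mono (changes_upto f)"
  by (rule mono_iff_le_Suc[THEN iffD2]) (simp add: changes_upto_Suc)

lemma changes_upto_le: "changes_upto f n \<le> n"
  by (induction n) (auto simp: changes_upto_Suc)

text \<open>A discrete intermediate value argument: the count starts at 0 and each step adds at most
  1.\<close>

lemma changes_upto_hits: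
  assumes "k \<le> changes_upto f n"
  obtains i where "i \<le> n" "changes_upto f i = k"
proof -
  have "\<exists>i\<le>n. int (changes_upto f i) = int k"
    using assms by (intro nat0_intermed_int_val) (auto simp: changes_upto_Suc)
  then show ?thesis
    using that by auto
qed

lemma sgn_changes_upto:
  assumes "\<forall>i\<le>n. f i \<noteq> 0"
  shows "sgn (f n) = (-1) ^ changes_upto f n * sgn (f 0)"
  using assms
proof (induction n)
  case (Suc n)
  then have IH: "sgn (f n) = (-1) ^ changes_upto f n * sgn (f 0)"
    by auto
  have "f n \<noteq> 0" "f (Suc n) \<noteq> 0"
    using Suc.prems by auto
  then have "sgn (f (Suc n)) = (if f n * f (Suc n) < 0 then - sgn (f n) else sgn (f n))"
    by (auto simp: sgn_real_def mult_less_0_iff)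
  then show ?case
    by (simp add: IH changes_upto_Suc)
qed simp

text \<open>Any position with count \<open>k\<close> can serve as \<open>p k\<close>: monotonicity
  of the count makes \<open>p\<close> increasing, and the parity of the count gives the
  sign.\<close>

lemma alternating_positions:
  assumes "\<forall>i\<le>n. f i \<noteq> 0" and "m \<le> changes_upto f n"
  obtains p where "strict_mono_on {..m} p" "\<And>k. k \<le> m \<Longrightarrow> p k \<le> n"
    "\<And>k. k \<le> m \<Longrightarrow> sgn (f (p k)) = (-1) ^ k * sgn (f 0)"
proof -
  have "\<exists>i\<le>n. changes_upto f i = k" if "k \<le> m" for k
    using changes_upto_hits[of k f n] that assms(2) by (metis le_trans)
  then obtain p where p: "\<And>k. k \<le> m \<Longrightarrow> p k \<le> n \<and> changes_upto f (p k) = k"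
    by metis
  have "p k < p l" if "k \<le> m" "l \<le> m" "k < l" for k l
    using that p[of k] p[of l] monoD[OF mono_changes_upto, of "p l" "p k" f]
    by (metis not_le)
  then have "strict_mono_on {..m} p"
    by (auto simp: strict_mono_on_def)
  moreover have "sgn (f (p k)) = (-1) ^ k * sgn (f 0)" if "k \<le> m" for k
    using sgn_changes_upto[of "p k" f] p[OF that] assms(1) by auto
  ultimately show ?thesis
    using that p by blast
qed

lemma sign_changes_list_of_vec:
  "sign_changes (list_of_vec v) = changes_upto (($) v) (dim_vec v - 1)"
proof -
  have "{i. Suc i < length (list_of_vec v) \<and> list_of_vec v ! i * list_of_vec v ! Suc i < 0} =
      {i. i < dim_vec v - 1 \<and> v $ i * v $ Suc i < 0}"
    by (auto simp: list_of_vec_index)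
  then show ?thesis
    by (simp add: sign_changes_def changes_upto_def)
qed

lemma S_minus_eq_changes_upto:
  assumes "\<forall>i < dim_vec v. v $ i \<noteq> 0"
  shows "S_minus v = changes_upto (($) v) (dim_vec v - 1)"
proof -
  have "filter (\<lambda>a. a \<noteq> 0) (list_of_vec v) = list_of_vec v"
    using assms by (auto simp: filter_id_conv in_set_conv_nth list_of_vec_index)
  then show ?thesis
    by (simp add: S_minus_def sign_changes_list_of_vec)
qed

lemma changes_upto_lt_if_repeated_sgn:
  assumes "i < n" and "sgn (f i) = sgn (f (Suc i))"
  shows "changes_upto f n < n"
proof -
  have "\<not> f i * f (Suc i) < 0"
    using assms(2) by (auto simp: sgn_real_def mult_less_0_iff split: if_splits)
  then have "{j. j < n \<and> f j * f (Suc j) < 0} \<subset> {..<n}"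
    using assms(1) by auto
  then have "card {j. j < n \<and> f j * f (Suc j) < 0} < card {..<n}"
    by (intro psubset_card_mono) auto
  then show ?thesis
    by (simp add: changes_upto_def)
qed

subsection \<open>Minors of a totally positive matrix with grouped columns\<close>

text \<open>Exactly \<open>k\<close> elements of the image lie below \<open>f k\<close>, so
  \<open>f k\<close> has rank \<open>k\<close> in it.\<close>

lemma pick_image_strict_mono:
  assumes "strict_mono_on {..<m} f" and "k < m"
  shows "pick (f ` {..<m}) k = f k"
proof -
  have "{a \<in> f ` {..<m}. a < f k} = f ` {..<k}"
    using assms by (auto simp: strict_mono_on_less)
  moreover have "inj_on f {..<k}"
    using assms by (intro inj_on_subset[OF strict_mono_on_imp_inj_on]) auto
  ultimately have "card {a \<in> f ` {..<m}. a < f k} = k"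
    by (simp add: card_image)
  then show ?thesis
    using pick_card_in_set[of "f k" "f ` {..<m}"] assms(2) by simp
qed

lemma submatrix_image:
  assumes "strict_mono_on {..<m} p" "strict_mono_on {..<m} q"
    and "\<And>k. k < m \<Longrightarrow> p k < dim_row A" "\<And>k. k < m \<Longrightarrow> q k < dim_col A"
  shows "submatrix A (p ` {..<m}) (q ` {..<m}) = mat m m (\<lambda>(k, l). A $$ (p k, q l))"
proof -
  have "{i. i < dim_row A \<and> i \<in> p ` {..<m}} = p ` {..<m}"
    "{i. i < dim_col A \<and> i \<in> q ` {..<m}} = q ` {..<m}"
    using assms by auto
  moreover have "card (p ` {..<m}) = m" "card (q ` {..<m}) = m"
    using assms by (simp_all add: card_image strict_mono_on_imp_inj_on)
  ultimately show ?thesis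
    unfolding submatrix_def using assms
    by (auto intro!: cong_mat simp: pick_image_strict_mono)
qed

text \<open>Increasing index functions replace the index sets of the definition. The case
  \<open>m = 0\<close>, with empty determinant 1, covers the minors met later for
  \<open>s = 0\<close>.\<close>

lemma totally_positive_det_pos:
  assumes "totally_positive t A" and "m \<le> t"
    and "strict_mono_on {..<m} p" "strict_mono_on {..<m} q"
    and "\<And>k. k < m \<Longrightarrow> p k < dim_row A" "\<And>k. k < m \<Longrightarrow> q k < dim_col A"
  shows "0 < det (mat m m (\<lambda>(k, l). A $$ (p k, q l)))"
proof (cases "m = 0")
  case False
  have "card (p ` {..<m}) = m" "card (q ` {..<m}) = m"
    using assms by (simp_all add: card_image strict_mono_on_imp_inj_on)
  then have "0 < det (submatrix A (p ` {..<m}) (q ` {..<m}))"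
    using assms False unfolding totally_positive_def by (auto simp: image_subset_iff)
  then show ?thesis
    using submatrix_image[OF assms(3-6)] by simp
qed simp

text \<open>Multilinearity in the columns: \<open>g\<close> chooses one summand from each column
  sum.\<close>

lemma det_grouped_columns:
  fixes a :: "nat \<Rightarrow> nat \<Rightarrow> 'a :: comm_ring_1"
  assumes "\<And>b. b < m \<Longrightarrow> finite (S b)"
  shows "det (mat m m (\<lambda>(k, b). \<Sum>j\<in>S b. c j * a k j)) =
    (\<Sum>g\<in>PiE {..<m} S. (\<Prod>b<m. c (g b)) * det (mat m m (\<lambda>(k, b). a k (g b))))"
proof -
  have perm: "p b < m" if "p permutes {0..<m}" "b < m" for p b
    using permutes_in_image[OF that(1), of b] that(2) by simp
  have "det (mat m m (\<lambda>(k, b). \<Sum>j\<in>S b. c j * a k j)) =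
      (\<Sum>p | p permutes {0..<m}. signof p * (\<Prod>b<m. \<Sum>j\<in>S b. c j * a (p b) j))"
    by (subst det_col[of _ m]) (auto intro!: sum.cong prod.cong simp: perm)
  also have "\<dots> = (\<Sum>p | p permutes {0..<m}. \<Sum>g\<in>PiE {..<m} S.
      (\<Prod>b<m. c (g b)) * (signof p * (\<Prod>b<m. a (p b) (g b))))"
    using assms by (subst prod_sum_PiE)
      (auto simp: sum_distrib_left prod.distrib algebra_simps)
  also have "\<dots> = (\<Sum>g\<in>PiE {..<m} S. (\<Prod>b<m. c (g b)) *
      (\<Sum>p | p permutes {0..<m}. signof p * (\<Prod>b<m. a (p b) (g b))))"
    by (subst sum.swap) (simp add: sum_distrib_left)
  also have "\<dots> = (\<Sum>g\<in>PiE {..<m} S. (\<Prod>b<m. c (g b)) * det (mat m m (\<lambda>(k, b). a k (g b))))"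
    by (subst det_col[of _ m]) (auto intro!: sum.cong prod.cong arg_cong2[of _ _ _ _ "(*)"] simp: perm)
  finally show ?thesis .
qed

text \<open>As the groups are ordered, every choice \<open>g\<close> is increasing, so each term of
  the expansion is a positive weight times a positive minor of \<open>A\<close>. Nonempty groups
  ensure that there is a term.\<close>

lemma totally_positive_grouped_det_pos:
  fixes c :: "nat \<Rightarrow> real"
  assumes "totally_positive t A" and "m \<le> t"
    and "strict_mono_on {..<m} p" "\<And>k. k < m \<Longrightarrow> p k < dim_row A"
    and S: "\<And>b. b < m \<Longrightarrow> S b \<noteq> {} \<and> S b \<subseteq> {..<dim_col A}"
    and incr: "\<And>b b' j j'. \<lbrakk>b < b'; b' < m; j \<in> S b; j' \<in> S b'\<rbrakk> \<Longrightarrow> j < j'"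
    and c: "\<And>j. j < dim_col A \<Longrightarrow> 0 < c j"
  shows "0 < det (mat m m (\<lambda>(k, b). \<Sum>j\<in>S b. c j * A $$ (p k, j)))"
proof -
  have fin: "finite (S b)" if "b < m" for b
    using S[OF that] finite_subset by blast
  have "0 < (\<Prod>b<m. c (g b)) * det (mat m m (\<lambda>(k, b). A $$ (p k, g b)))"
    if g: "g \<in> PiE {..<m} S" for g
  proof (rule mult_pos_pos)
    have gS: "g b \<in> S b" if "b < m" for b
      using g that by auto
    have g_less: "g b < dim_col A" if "b < m" for b
      using gS[OF that] S[OF that] by auto
    then show "0 < (\<Prod>b<m. c (g b))"
      using c by (auto intro!: prod_pos)
    have "strict_mono_on {..<m} g"
    proof (rule strict_mono_onI)
      fix b b' assume "b \<in> {..<m}" "b' \<in> {..<m}" "b < b'"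
      then show "g b < g b'"
        using incr[OF \<open>b < b'\<close> _ gS gS] by simp
    qed
    then show "0 < det (mat m m (\<lambda>(k, b). A $$ (p k, g b)))"
      using totally_positive_det_pos[OF assms(1-3) _ assms(4)] g_less by blast
  qed
  moreover have "finite (PiE {..<m} S)" "PiE {..<m} S \<noteq> {}"
    using fin S by (auto intro!: finite_PiE simp: PiE_eq_empty_iff)
  ultimately show ?thesis
    by (subst det_grouped_columns) (auto intro!: sum_pos fin)
qed

subsection \<open>Variation diminution\<close>

lemma alternating_rows_start_sign:
  fixes A :: "real mat"
  assumes A: "A \<in> carrier_mat r r" and tp: "totally_positive (r - 1) A"
    and x: "x \<in> carrier_vec r" and nz: "\<forall>i<r. x $ i \<noteq> 0"
    and s: "changes_upto (($) x) (r - 1) = s" and "Suc s < r"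
    and p: "strict_mono_on {..s} p" "\<And>k. k \<le> s \<Longrightarrow> p k < r"
    and \<sigma>: "\<sigma> \<noteq> 0" "\<And>k. k \<le> s \<Longrightarrow> 0 \<le> (-1) ^ k * \<sigma> * (A *\<^sub>v x) $ p k"
  shows "0 < \<sigma> * x $ 0"
proof -
  \<comment> \<open>The \<open>b\<close>-th block of constant sign of \<open>x\<close>.\<close>
  define S where "S b = {j. j < r \<and> changes_upto (($) x) j = b}" for b
  define B where "B = mat (Suc s) (Suc s) (\<lambda>(k, b). \<Sum>j\<in>S b. \<bar>x $ j\<bar> * A $$ (p k, j))"
  define d where "d = vec (Suc s) (\<lambda>b. (-1) ^ b * sgn (x $ 0))"
  define y where "y = vec (Suc s) (\<lambda>k. (A *\<^sub>v x) $ p k)"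
  define R where "R = replace_col B y 0"
  have B: "B \<in> carrier_mat (Suc s) (Suc s)" and d: "d \<in> carrier_vec (Suc s)"
    by (simp_all add: B_def d_def)
  have R: "R \<in> carrier_mat (Suc s) (Suc s)"
    by (simp add: R_def replace_col_def B_def)
  have S_ne: "S b \<noteq> {}" if "b \<le> s" for b
    using changes_upto_hits[of b "($) x" "r - 1"] that s \<open>Suc s < r\<close> unfolding S_def
    by fastforce
  have S_incr: "j < j'" if "b < b'" "j \<in> S b" "j' \<in> S b'" for b b' j j'
    using that monoD[OF mono_changes_upto, of j' j "($) x"] unfolding S_def
    by (metis (mono_tags, lifting) mem_Collect_eq not_le)

  \<comment> \<open>On block \<open>b\<close> the sign of \<open>x\<close> is
    \<open>(-1) ^ b * sgn (x $ 0)\<close>, so the weights restore the coordinates of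
    \<open>x\<close>.\<close>
  have "B *\<^sub>v d = y"
  proof (rule eq_vecI)
    fix k assume "k < dim_vec y"
    then have k: "k \<le> s"
      by (simp add: y_def)
    have abs_x: "\<bar>x $ j\<bar> * ((-1) ^ b * sgn (x $ 0)) = x $ j" if "j \<in> S b" for j b
    proof -
      have "(-1) ^ b * sgn (x $ 0) = sgn (x $ j)"
        using sgn_changes_upto[of j "($) x"] that nz by (simp add: S_def)
      then show ?thesis
        by (simp add: abs_mult_sgn)
    qed
    have "(B *\<^sub>v d) $ k = (\<Sum>b<Suc s. (\<Sum>j\<in>S b. \<bar>x $ j\<bar> * A $$ (p k, j)) * ((-1) ^ b * sgn (x $ 0)))"
      using k by (simp add: B_def d_def scalar_prod_def lessThan_atLeast0 del: sum.lessThan_Suc)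
    also have "\<dots> = (\<Sum>b<Suc s. \<Sum>j\<in>S b. A $$ (p k, j) * x $ j)"
    proof (rule sum.cong[OF refl])
      fix b
      show "(\<Sum>j\<in>S b. \<bar>x $ j\<bar> * A $$ (p k, j)) * ((-1) ^ b * sgn (x $ 0)) =
          (\<Sum>j\<in>S b. A $$ (p k, j) * x $ j)"
        unfolding sum_distrib_right
      proof (rule sum.cong[OF refl])
        fix j assume "j \<in> S b"
        from abs_x[OF this]
        show "\<bar>x $ j\<bar> * A $$ (p k, j) * ((-1) ^ b * sgn (x $ 0)) = A $$ (p k, j) * x $ j"
          by (metis mult.assoc mult.commute)
      qed
    qed
    also have "\<dots> = (\<Sum>j<r. A $$ (p k, j) * x $ j)"
    proof -
      \<comment> \<open>The count is monotone and equals \<open>s\<close> at \<open>r - 1\<close>,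
        so the blocks 0 to \<open>s\<close> partition all columns.\<close>
      have "changes_upto (($) x) ` {..<r} \<subseteq> {..<Suc s}"
        using s monoD[OF mono_changes_upto, of _ "r - 1" "($) x"] by (auto simp: less_Suc_eq_le)
      moreover have "S b = {j \<in> {..<r}. changes_upto (($) x) j = b}" for b
        by (auto simp: S_def)
      ultimately show ?thesis
        using sum.group[of "{..<r}" "{..<Suc s}" "changes_upto (($) x)" "\<lambda>j. A $$ (p k, j) * x $ j"]
        by simp
    qed
    also have "\<dots> = y $ k"
      using A x k p(2)[OF k] by (simp add: y_def scalar_prod_def lessThan_atLeast0)
    finally show "(B *\<^sub>v d) $ k = y $ k" .
  qed (simp add: B_def y_def)
  then have cramer: "det R = sgn (x $ 0) * det B"
    using cramer_lemma_mat[OF B d, of 0] by (simp add: R_def d_def)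

  note grouped = totally_positive_grouped_det_pos[OF tp]
  have abs_pos: "0 < \<bar>x $ j\<bar>" if "j < dim_col A" for j
    using that A nz by auto
  have S_sub: "S b \<subseteq> {..<dim_col A}" for b
    using A by (auto simp: S_def)
  have detB: "0 < det B"
    unfolding B_def
  proof (rule grouped)
    show "strict_mono_on {..<Suc s} p"
      using p(1) by (simp add: lessThan_Suc_atMost)
    show "p k < dim_row A" if "k < Suc s" for k
      using p(2)[of k] that A by simp
    show "S b \<noteq> {} \<and> S b \<subseteq> {..<dim_col A}" if "b < Suc s" for b
      using S_ne[of b] S_sub that by simp
    show "Suc s \<le> r - 1"
      using \<open>Suc s < r\<close> by simp
    show "j < j'" if "b < b'" "j \<in> S b" "j' \<in> S b'" for b b' j j'
      using S_incr that .
  qed (fact abs_pos)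
  \<comment> \<open>Deleting column 0 removes the replaced column, leaving blocks 1 to
    \<open>s\<close> of \<open>B\<close>; \<open>insert_index k\<close> skips row
    \<open>k\<close>.\<close>
  have minor: "0 < det (mat_delete R k 0)" if k: "k \<le> s" for k
  proof -
    have "mat_delete R k 0 =
        mat s s (\<lambda>(k', b). \<Sum>j\<in>S (Suc b). \<bar>x $ j\<bar> * A $$ ((p \<circ> insert_index k) k', j))"
      using k by (intro eq_matI)
        (auto simp: mat_delete_def R_def replace_col_def B_def insert_index_def)
    also have "0 < det \<dots>"
    proof (rule grouped)
      show "s \<le> r - 1"
        using \<open>Suc s < r\<close> by simp
      show "strict_mono_on {..<s} (p \<circ> insert_index k)"
        using p(1) unfolding strict_mono_on_def insert_index_def by auto
      show "(p \<circ> insert_index k) k' < dim_row A" if "k' < s" for k'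
        using p(2) that A by (simp add: insert_index_def)
      show "S (Suc b) \<noteq> {} \<and> S (Suc b) \<subseteq> {..<dim_col A}" if "b < s" for b
        using S_ne[of "Suc b"] S_sub that by simp
      show "j < j'" if "b < b'" "j \<in> S (Suc b)" "j' \<in> S (Suc b')" for b b' j j'
        using S_incr[OF _ that(2,3)] that(1) by simp
    qed (fact abs_pos)
    finally show ?thesis .
  qed
  \<comment> \<open>The cofactor signs in column 0 alternate just as the entries of \<open>y\<close>
    weakly do, so no term is negative.\<close>
  have "\<sigma> * det R = (\<Sum>k<Suc s. \<sigma> * (R $$ (k, 0) * cofactor R k 0))"
    using laplace_expansion_column[OF R, of 0] by (simp add: sum_distrib_left del: sum.lessThan_Suc)
  also have "\<dots> = (\<Sum>k<Suc s. ((-1) ^ k * \<sigma> * (A *\<^sub>v x) $ p k) * det (mat_delete R k 0))"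
    by (intro sum.cong) (auto simp: R_def replace_col_def B_def y_def cofactor_def)
  also have "0 \<le> \<dots>"
  proof (rule sum_nonneg)
    fix k assume "k \<in> {..<Suc s}"
    then have "k \<le> s"
      by simp
    from mult_nonneg_nonneg[OF \<sigma>(2)[OF this] less_imp_le[OF minor[OF this]]]
    show "0 \<le> (-1) ^ k * \<sigma> * (A *\<^sub>v x) $ p k * det (mat_delete R k 0)" .
  qed
  finally have "0 \<le> (\<sigma> * sgn (x $ 0)) * det B"
    by (simp add: cramer)
  then have "0 \<le> \<sigma> * sgn (x $ 0)"
    using detB by (simp add: zero_le_mult_iff)
  \<comment> \<open>Weak alternation still yields a strict sign, since neither \<sigma> nor
    \<open>x $ 0\<close> vanishes.\<close>
  then show ?thesis
    using \<sigma>(1) nz \<open>Suc s < r\<close> by (auto simp: sgn_real_def zero_le_mult_iff zero_less_mult_iff split: if_splits)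
qed

section \<open>Fillings of the zero entries and \<open>S_plus\<close>\<close>

lemma zero_fillings_nonzero:
  assumes "w \<in> zero_fillings v" and "i < dim_vec v"
  shows "w $ i \<noteq> 0"
  using assms by (auto simp: zero_fillings_def split: if_splits)

lemma zero_fillings_sgn_mult_nonneg:
  assumes "w \<in> zero_fillings v" and "i < dim_vec v"
  shows "0 \<le> sgn (w $ i) * v $ i"
  using assms by (cases "v $ i = 0") (auto simp: zero_fillings_def sgn_real_def)

text \<open>Counts of fillings are bounded by the dimension and some filling exists, so the
  \<open>Max\<close> in \<open>S_plus\<close> is taken over a finite nonempty set.\<close>

lemma S_plus_attained:
  assumes "v \<noteq> 0\<^sub>v (dim_vec v)"
  shows "\<exists>w\<in>zero_fillings v. sign_changes (list_of_vec w) = S_plus v"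
    and "w \<in> zero_fillings v \<Longrightarrow> sign_changes (list_of_vec w) \<le> S_plus v"
proof -
  let ?C = "(\<lambda>w. sign_changes (list_of_vec w)) ` zero_fillings v"
  have "sign_changes (list_of_vec w) \<le> dim_vec v" if "w \<in> zero_fillings v" for w
    using changes_upto_le[of "($) w" "dim_vec v - 1"] that
    by (simp add: sign_changes_list_of_vec zero_fillings_def)
  then have "?C \<subseteq> {..dim_vec v}"
    by blast
  then have fin: "finite ?C"
    using finite_subset by blast
  have "vec (dim_vec v) (\<lambda>i. if v $ i = 0 then 1 else v $ i) \<in> zero_fillings v"
    by (auto simp: zero_fillings_def)
  then have "Max ?C \<in> ?C"
    using fin by (intro Max_in) auto
  then show "\<exists>w\<in>zero_fillings v. sign_changes (list_of_vec w) = S_plus v"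
    using assms by (auto simp: S_plus_def)
  show "sign_changes (list_of_vec w) \<le> S_plus v" if "w \<in> zero_fillings v"
    using that fin assms by (auto simp: S_plus_def)
qed

lemma S_plus_signI:
  assumes "v \<noteq> 0\<^sub>v (dim_vec v)"
    and "\<And>w. \<lbrakk>w \<in> zero_fillings v; sign_changes (list_of_vec w) = S_plus v\<rbrakk> \<Longrightarrow> sgn (w $ i) = t"
  shows "S_plus_sign v i t"
proof -
  let ?W = "{w \<in> zero_fillings v. sign_changes (list_of_vec w) = S_plus v}"
  have "?W \<noteq> {}"
    using S_plus_attained(1)[OF assms(1)] by blast
  moreover have "(\<lambda>w. sgn (w $ i)) ` ?W = (\<lambda>w. t) ` ?W"
    using assms(2) by (intro image_cong) auto
  ultimately show ?thesis
    unfolding S_plus_sign_def by (simp only: image_constant_conv if_False)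
qed

lemma filling_changes_bound:
  fixes A :: "real mat"
  assumes A: "A \<in> carrier_mat r r" and tp: "totally_positive (r - 1) A"
    and x: "x \<in> carrier_vec r" and nz: "\<forall>i<r. x $ i \<noteq> 0"
    and s: "changes_upto (($) x) (r - 1) = s" and "Suc s < r"
    and w: "w \<in> zero_fillings (A *\<^sub>v x)"
  shows "changes_upto (($) w) (r - 1) \<le> s"
    and "changes_upto (($) w) (r - 1) = s \<Longrightarrow> sgn (w $ 0) = sgn (x $ 0)"
proof -
  have wnz: "\<forall>i\<le>r - 1. w $ i \<noteq> 0"
    using zero_fillings_nonzero[OF w] A \<open>Suc s < r\<close> by auto
  have wy: "0 \<le> sgn (w $ i) * (A *\<^sub>v x) $ i" if "i < r" for i
    using zero_fillings_sgn_mult_nonneg[OF w] that A by simp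
  note start = alternating_rows_start_sign[OF A tp x nz s \<open>Suc s < r\<close>]
  \<comment> \<open>Assuming only at least \<open>s\<close> changes serves both the equality case
    and the contradiction below.\<close>
  have pos: "0 < sgn (w $ 0) * x $ 0" if le: "s \<le> changes_upto (($) w) (r - 1)"
  proof -
    obtain p where p: "strict_mono_on {..s} p" "\<And>k. k \<le> s \<Longrightarrow> p k \<le> r - 1"
      "\<And>k. k \<le> s \<Longrightarrow> sgn (w $ p k) = (-1) ^ k * sgn (w $ 0)"
      using alternating_positions[OF wnz le] by blast
    have less: "p k < r" if "k \<le> s" for k
      using p(2)[OF that] \<open>Suc s < r\<close> by linarith
    show ?thesis
    proof (rule start[OF p(1)])
      show "sgn (w $ 0) \<noteq> 0"
        using wnz by (simp add: sgn_zero_iff)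
      show "0 \<le> (-1) ^ k * sgn (w $ 0) * (A *\<^sub>v x) $ p k" if "k \<le> s" for k
        using wy[OF less[OF that]] p(3)[OF that] by simp
    qed (fact less)
  qed
  show "changes_upto (($) w) (r - 1) \<le> s"
  proof (rule ccontr)
    assume "\<not> ?thesis"
    then have le: "Suc s \<le> changes_upto (($) w) (r - 1)"
      by simp
    obtain p where p: "strict_mono_on {..Suc s} p" "\<And>k. k \<le> Suc s \<Longrightarrow> p k \<le> r - 1"
      "\<And>k. k \<le> Suc s \<Longrightarrow> sgn (w $ p k) = (-1) ^ k * sgn (w $ 0)"
      using alternating_positions[OF wnz le] by blast
    have less: "p (Suc k) < r" if "k \<le> s" for k
      using p(2)[of "Suc k"] that \<open>Suc s < r\<close> by linarith
    \<comment> \<open>Without its first row the alternation starts with the opposite sign, against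
      \<open>pos\<close>.\<close>
    have "0 < - sgn (w $ 0) * x $ 0"
    proof (rule start[of "\<lambda>k. p (Suc k)"])
      show "strict_mono_on {..s} (\<lambda>k. p (Suc k))"
        using p(1) by (auto simp: strict_mono_on_def)
      show "- sgn (w $ 0) \<noteq> 0"
        using wnz by (simp add: sgn_zero_iff)
      show "0 \<le> (-1) ^ k * - sgn (w $ 0) * (A *\<^sub>v x) $ p (Suc k)" if "k \<le> s" for k
        using wy[OF less[OF that]] p(3)[of "Suc k"] that by simp
    qed (fact less)
    then show False
      using pos le by simp
  qed
  show "sgn (w $ 0) = sgn (x $ 0)" if "changes_upto (($) w) (r - 1) = s"
    using pos that by (auto simp: sgn_real_def zero_less_mult_iff split: if_splits)
qed

text \<open>A zero image weakly alternates with either starting sign, forcing both signs on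
  \<open>x $ 0\<close>. This rules out the conventional value of \<open>S_plus\<close> at 0.\<close>

lemma mult_vec_nonzero:
  fixes A :: "real mat"
  assumes A: "A \<in> carrier_mat r r" and tp: "totally_positive (r - 1) A"
    and x: "x \<in> carrier_vec r" and nz: "\<forall>i<r. x $ i \<noteq> 0"
    and s: "changes_upto (($) x) (r - 1) = s" and "Suc s < r"
  shows "A *\<^sub>v x \<noteq> 0\<^sub>v r"
proof
  assume zero: "A *\<^sub>v x = 0\<^sub>v r"
  have "0 < \<sigma> * x $ 0" if "\<sigma> \<noteq> 0" for \<sigma>
    using alternating_rows_start_sign[OF A tp x nz s \<open>Suc s < r\<close>, of id \<sigma>] that \<open>Suc s < r\<close>
    by (simp add: zero strict_mono_on_def)
  from this[of 1] this[of "-1"] show False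
    by simp
qed

theorem theorem5p1:
  fixes A :: "real mat" and x :: "real vec" and r :: nat
  assumes "x \<in> carrier_vec r"
    and "A \<in> carrier_mat r r"
    and "\<forall>i < r. x $ i \<noteq> 0"
    and "\<exists>i. Suc i < r \<and> sgn (x $ i) = sgn (x $ Suc i)"
    and "totally_positive (r - 1) A"
  shows "(S_plus (A *\<^sub>v x) \<le> S_minus x \<and>
          (S_plus (A *\<^sub>v x) = S_minus x \<longrightarrow>
             S_plus_sign (A *\<^sub>v x) 0 (sgn (x $ 0)) \<and>
             S_plus_sign (A *\<^sub>v x) (r - 1) (sgn (x $ (r - 1))))) \<and>
         (\<exists>i < r. x $ i * (A *\<^sub>v x) $ i > 0)"
proof -
  define s where "s = changes_upto (($) x) (r - 1)"
  obtain i where "Suc i < r" "sgn (x $ i) = sgn (x $ Suc i)"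
    using assms(4) by blast
  \<comment> \<open>The repeated sign keeps the number of blocks, \<open>s + 1\<close>, within the
    order \<open>r - 1\<close> of total positivity.\<close>
  then have s_less: "Suc s < r"
    using changes_upto_lt_if_repeated_sgn[of i "r - 1" "($) x"] by (simp add: s_def less_diff_conv)
  note hyps = assms(2,5,1,3) s_def[symmetric] s_less
  let ?y = "A *\<^sub>v x"
  have dim: "dim_vec x = r" "dim_vec ?y = r" "dim_row A = r"
    using assms by auto
  have Sm: "S_minus x = s"
    using S_minus_eq_changes_upto[of x] assms(3) by (simp add: dim s_def)
  have y_ne: "?y \<noteq> 0\<^sub>v (dim_vec ?y)"
    using mult_vec_nonzero[OF hyps] by (simp add: dim)
  have ch: "sign_changes (list_of_vec w) = changes_upto (($) w) (r - 1)" if "w \<in> zero_fillings ?y" for w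
    using that by (simp add: sign_changes_list_of_vec zero_fillings_def dim)
  have le: "S_plus ?y \<le> s"
    using S_plus_attained(1)[OF y_ne] filling_changes_bound(1)[OF hyps] ch by metis
  have signs: "sgn (w $ 0) = sgn (x $ 0)" "sgn (w $ (r - 1)) = sgn (x $ (r - 1))"
    if "w \<in> zero_fillings ?y" "changes_upto (($) w) (r - 1) = s" for w
  proof -
    show first: "sgn (w $ 0) = sgn (x $ 0)"
      using filling_changes_bound(2)[OF hyps] that by blast
    have "\<forall>i\<le>r - 1. w $ i \<noteq> 0" "\<forall>i\<le>r - 1. x $ i \<noteq> 0"
      using zero_fillings_nonzero[OF that(1)] assms(3) s_less by (auto simp: dim)
    \<comment> \<open>Equal first signs and equally many changes force equal last signs.\<close>
    from this[THEN sgn_changes_upto] show "sgn (w $ (r - 1)) = sgn (x $ (r - 1))"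
      by (simp only: first that(2) s_def[symmetric])
  qed
  have "S_plus_sign ?y 0 (sgn (x $ 0)) \<and> S_plus_sign ?y (r - 1) (sgn (x $ (r - 1)))"
    if eq: "S_plus ?y = s"
  proof -
    have "changes_upto (($) w) (r - 1) = s"
      if "w \<in> zero_fillings ?y" "sign_changes (list_of_vec w) = S_plus ?y" for w
      using ch[OF that(1)] that(2) eq by metis
    then show ?thesis
      using signs by (auto intro!: S_plus_signI[OF y_ne])
  qed
  moreover have "\<exists>i<r. 0 < x $ i * ?y $ i"
  proof (rule ccontr)
    assume "\<not> ?thesis"
    then have neg: "x $ i * ?y $ i \<le> 0" if "i < r" for i
      using that not_le by blast
    \<comment> \<open>By \<open>neg\<close>, nonzero entries of the image already oppose
      \<open>x\<close> in sign; filling the zeros likewise gives \<open>w\<close> the signs of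
      \<open>-x\<close> throughout, hence the same changes as \<open>x\<close>.\<close>
    define w where "w = vec r (\<lambda>i. if ?y $ i = 0 then - sgn (x $ i) else ?y $ i)"
    have w: "w \<in> zero_fillings ?y"
      using assms(3) by (auto simp: zero_fillings_def w_def dim sgn_real_def)
    have sgn_w: "sgn (w $ i) = - sgn (x $ i)" if "i < r" for i
      using neg[OF that] assms(3) that
      by (auto simp: w_def sgn_real_def mult_le_0_iff)
    have "w $ i * w $ Suc i < 0 \<longleftrightarrow> x $ i * x $ Suc i < 0" if "i < r - 1" for i
    proof -
      have "sgn (w $ i * w $ Suc i) = sgn (x $ i * x $ Suc i)"
        using sgn_w[of i] sgn_w[of "Suc i"] that by (simp add: sgn_mult)
      then show ?thesis
        by (metis sgn_less)
    qed
    then have "changes_upto (($) w) (r - 1) = s"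
      unfolding s_def changes_upto_def by (metis (no_types, lifting))
    from signs(1)[OF w this] have "sgn (x $ 0) = 0"
      using sgn_w[of 0] s_less by simp
    then show False
      using assms(3) s_less by (simp add: sgn_zero_iff)
  qed
  ultimately show ?thesis
    using le Sm by simp
qed

end
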